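(* Let $z\in\mathbb{Z}[k]\setminus\mathcal{D}$, that is, $\mathrm{Re}(z)\neq 0$ (we can suppose $\mathrm{Re}(z)>0$). Then: (a) If $z=p+ky$, with $p$ a prime number, then $z$ is irreducible in $\mathbb{Z}[k]$. (b) If $z=x+ky$, with $x$ not a power of a prime number, then $z$ is reducible in $\mathbb{Z}[k]$. (c) If $z=p^\gamma+ky$, with $p$ a prime number and $\gamma\geq 2$, then $z$ is reducible in $\mathbb{Z}[k]$ if and only if $p\mid y$.
   Context: $\mathbb{Z}[k]$ denotes the commutative ring of formal expressions $x+ky$ with $x,y\in\mathbb{Z}$, with componentwise addition and multiplication determined by distributivity and $k^2=0$; that is, $\mathbb{Z}[k]\cong\mathbb{Z}[X]/(X^2)$. For $z=x+ky$, $\mathrm{Re}(z)=x$. $\mathcal{D}=\{ky : y\in\mathbb{Z}\}$ is the set of zero divisors of $\mathbb{Z}[k]$ (including $0$). An element $a$ is irreducible if it is non-zero, not a unit, and $a=zw$ implies that $z$ is a unit or $w$ is a unit. An element is reducible if it is a product of two non-units. Throughout, $x,y\in\mathbb{Z}$. *)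

theory Defs
  imports "HOL-Computational_Algebra.Primes"
begin

text \<open>The ring of formal expressions \<open>x + k y\<close> with integer \<open>x, y\<close> and \<open>k\<^sup>2 = 0\<close>;
  \<open>ZK x y\<close> stands for \<open>x + k y\<close>.\<close>

datatype zk = ZK (re_part: int) (k_part: int)

lemma zk_eq_iff: "z = w \<longleftrightarrow> re_part z = re_part w \<and> k_part z = k_part w"
  by (auto intro: zk.expand)

instantiation zk :: comm_ring_1
begin

definition "0 = ZK 0 0"
definition "1 = ZK 1 0"
definition "z + w = ZK (re_part z + re_part w) (k_part z + k_part w)"
definition "- z = ZK (- re_part z) (- k_part z)"
definition "z - w = ZK (re_part z - re_part w) (k_part z - k_part w)"
definition "z * w = ZK (re_part z * re_part w)
                       (re_part z * k_part w + k_part z * re_part w)"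

instance
  by standard
    (simp_all add: zk_eq_iff zero_zk_def one_zk_def plus_zk_def uminus_zk_def
      minus_zk_def times_zk_def algebra_simps)

end

lemma parts_simps [simp]:
  "re_part 0 = 0" "k_part 0 = 0" "re_part 1 = 1" "k_part 1 = 0"
  "re_part (z + w) = re_part z + re_part w" "k_part (z + w) = k_part z + k_part w"
  "re_part (- z) = - re_part z" "k_part (- z) = - k_part z"
  "re_part (z - w) = re_part z - re_part w" "k_part (z - w) = k_part z - k_part w"
  "re_part (z * w) = re_part z * re_part w"
  "k_part (z * w) = re_part z * k_part w + k_part z * re_part w"
  by (simp_all add: zero_zk_def one_zk_def plus_zk_def uminus_zk_def
      minus_zk_def times_zk_def)

definition kk :: zk where "kk = ZK 0 1"

lemma parts_kk [simp]: "re_part kk = 0" "k_part kk = 1"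
  by (simp_all add: kk_def)

lemma kk_square: "kk\<^sup>2 = 0"
  by (simp add: zk_eq_iff power2_eq_square)

lemma parts_of_nat [simp]: "re_part (of_nat n) = int n" "k_part (of_nat n) = 0"
  by (induction n) auto

lemma parts_of_int [simp]: "re_part (of_int x) = x" "k_part (of_int x) = 0"
  by (cases x; simp)+

lemma ZK_eq: "ZK x y = of_int x + kk * of_int y"
  by (simp add: zk_eq_iff)

definition zero_divisors :: "zk set" where
  "zero_divisors = {kk * of_int y | y. True}"

lemma zero_divisors_iff_re_part: "z \<in> zero_divisors \<longleftrightarrow> re_part z = 0"
  by (auto simp: zero_divisors_def zk_eq_iff)

lemma zero_divisors_iff: "z \<in> zero_divisors \<longleftrightarrow> (\<exists>w. w \<noteq> 0 \<and> z * w = 0)"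
proof
  assume "z \<in> zero_divisors"
  then have "kk \<noteq> 0 \<and> z * kk = 0"
    by (simp add: zero_divisors_iff_re_part zk_eq_iff)
  then show "\<exists>w. w \<noteq> 0 \<and> z * w = 0" by blast
next
  assume "\<exists>w. w \<noteq> 0 \<and> z * w = 0"
  then show "z \<in> zero_divisors"
    by (auto simp: zero_divisors_iff_re_part zk_eq_iff)
qed

text \<open>The complementary notion \<open>irreducible\<close> is the library's, where being a unit is
  expressed as dividing \<open>1\<close>.\<close>

definition reducible :: "'a::comm_semiring_1 \<Rightarrow> bool" where
  "reducible z \<longleftrightarrow> (\<exists>a b. \<not> a dvd 1 \<and> \<not> b dvd 1 \<and> z = a * b)"

end

theory Submission
  imports Defs
begin

text \<open>Since \<open>(x + k y) (x - k y) = x\<^sup>2\<close>, an element is a unit iff its real part is \<open>\<plusminus>1\<close>, so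
  a factorization into non-units splits the real part into non-unit integers. If the real part is
  \<open>a b\<close> with \<open>a, b\<close> coprime non-units, Bezout coefficients for \<open>y\<close> lift this
  to a factorization in \<open>\<int>[k]\<close>. If it is a prime power \<open>p\<^sup>\<gamma>\<close>, both factors have
  real part divisible by \<open>p\<close>, which forces \<open>p\<close> to divide \<open>y\<close>.\<close>

lemma zk_unit_iff: "z dvd 1 \<longleftrightarrow> re_part z dvd 1" for z :: zk
proof
  assume "z dvd 1"
  then obtain w where "1 = z * w" ..
  then have "1 = re_part z * re_part w" by (simp add: zk_eq_iff)
  then show "re_part z dvd 1" ..
next
  assume "re_part z dvd 1"
  then have "re_part z * re_part z = 1" by (auto simp: zdvd1_eq abs_if split: if_splits)
  then have "1 = z * ZK (re_part z) (- k_part z)" by (simp add: zk_eq_iff)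
  then show "z dvd 1" ..
qed

text \<open>Negation flips the sign of the real part, so invariance of both notions under it
  justifies restricting to positive real part.\<close>

lemma irreducible_uminus_iff:
  fixes z :: "'a::comm_ring_1"
  shows "irreducible (- z) \<longleftrightarrow> irreducible z"
proof -
  have "irreducible (- w)" if "irreducible w" for w :: 'a
  proof (rule irreducibleI)
    fix a b assume "- w = a * b"
    then have "w = - a * b" by (metis minus_minus mult_minus_left)
    then show "a dvd 1 \<or> b dvd 1" using irreducibleD[OF that] by fastforce
  qed (use that in \<open>auto simp: irreducible_def\<close>)
  from this[of z] this[of "- z"] show ?thesis by auto
qed

lemma reducible_uminus_iff:
  fixes z :: "'a::comm_ring_1"
  shows "reducible (- z) \<longleftrightarrow> reducible z"
proof -
  have "reducible (- w)" if "reducible w" for w :: 'a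
  proof -
    from that obtain a b where "\<not> a dvd 1" "\<not> b dvd 1" "w = a * b"
      by (auto simp: reducible_def)
    then have "\<not> - a dvd 1" "\<not> b dvd 1" "- w = - a * b" by auto
    then show ?thesis unfolding reducible_def by blast
  qed
  from this[of z] this[of "- z"] show ?thesis by auto
qed

text \<open>The real part is multiplicative and detects units, so every factorization projects to
  one in the integers. The converse fails: \<open>p ^ n + k y\<close> with n \<ge> 2 and y prime to
  p is irreducible.\<close>

lemma irreducible_zk_if_irreducible_re_part:
  assumes "irreducible (re_part z)"
  shows "irreducible z"
proof (rule irreducibleI)
  fix a b assume "z = a * b"
  then have "re_part z = re_part a * re_part b" by simp
  then show "a dvd 1 \<or> b dvd 1"
    unfolding zk_unit_iff by (rule irreducibleD[OF assms])
qed (use assms in \<open>auto simp: irreducible_def zk_unit_iff\<close>)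

text \<open>A lift (a + k s)(b + k t) has k-part a t + s b, so s and t must solve a linear equation
  with coprime coefficients: Bezout coefficients scaled by \<open>k_part z\<close> do.\<close>

lemma reducible_if_coprime_factors:
  assumes "re_part z = a * b" "coprime a b" "\<not> a dvd 1" "\<not> b dvd 1"
  shows "reducible z"
proof -
  obtain u v where "u * a + v * b = 1"
    using \<open>coprime a b\<close> bezout_int[of a b] by auto
  then have "k_part z = k_part z * (u * a + v * b)" by simp
  then have "z = ZK a (k_part z * v) * ZK b (k_part z * u)"
    using assms(1) by (simp add: zk_eq_iff algebra_simps)
  then show ?thesis
    unfolding reducible_def using assms(3,4) by (metis zk_unit_iff zk.sel(1))
qed

text \<open>Split off the full power of one prime divisor of x; the cofactor is coprime to
  it.\<close>

lemma coprime_factors_if_not_prime_power: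
  fixes x :: nat
  assumes "x > 0" "\<nexists>p n. prime p \<and> x = p ^ n"
  obtains a b where "x = a * b" "coprime a b" "a \<noteq> 1" "b \<noteq> 1"
proof -
  \<comment> \<open>The exponent 0 is allowed, so 1 counts as the prime power
    \<open>2 ^ 0\<close>.\<close>
  have "x \<noteq> 1" using assms(2) two_is_prime_nat by (metis power_0)
  then obtain p where p: "prime p" "p dvd x" using prime_factor_nat by blast
  then have "\<not> is_unit p" by auto
  obtain m where m: "x = p ^ multiplicity p x * m" "\<not> p dvd m"
    using multiplicity_decompose'[of x p] assms(1) \<open>\<not> is_unit p\<close> by blast
  show ?thesis
  proof
    show "x = p ^ multiplicity p x * m" by (fact m(1))
    show "coprime (p ^ multiplicity p x) m"
      using p(1) m(2) by (simp add: prime_imp_coprime)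
    \<comment> \<open>Otherwise x = m, although p divides x but not m.\<close>
    show "p ^ multiplicity p x \<noteq> 1"
      using m p by (metis mult_1)
    show "m \<noteq> 1"
      using m(1) p(1) assms(2) by (metis mult.right_neutral)
  qed
qed

lemma reducible_if_re_part_not_prime_power:
  assumes "re_part z > 0" "\<nexists>(p::nat) n. prime p \<and> re_part z = int p ^ n"
  shows "reducible z"
proof -
  define x where "x = nat (re_part z)"
  have x: "re_part z = int x" "x > 0" using assms(1) by (simp_all add: x_def)
  moreover have "\<nexists>p n. prime p \<and> x = p ^ n" using assms(2) x(1) by (metis of_nat_power)
  ultimately obtain a b where "x = a * b" "coprime a b" "a \<noteq> 1" "b \<noteq> 1"
    using coprime_factors_if_not_prime_power by blast
  then show ?thesis
    using x(1) by (intro reducible_if_coprime_factors[of z "int a" "int b"]) auto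
qed

text \<open>A prime factor q of a divides \<open>p ^ n\<close>, hence p, and so equals p.\<close>

lemma prime_dvd_if_dvd_prime_power:
  fixes p a :: "'a::factorial_semiring"
  assumes "prime p" "a dvd p ^ n" "\<not> is_unit a"
  shows "p dvd a"
proof -
  have "a \<noteq> 0" using assms(1,2) by auto
  then obtain q where q: "q dvd a" "prime q" using prime_divisor_exists assms(3) by blast
  then have "q dvd p ^ n" using assms(2) dvd_trans by blast
  then have "q dvd p" using q(2) prime_dvd_power by blast
  then show ?thesis using primes_dvd_imp_eq[OF q(2) assms(1)] q(1) by simp
qed

lemma reducible_prime_power_iff:
  fixes p :: int
  assumes "prime p" "n \<ge> 2" "re_part z = p ^ n"
  shows "reducible z \<longleftrightarrow> p dvd k_part z"
proof
  assume "reducible z"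
  then obtain a b where ab: "\<not> re_part a dvd 1" "\<not> re_part b dvd 1" "z = a * b"
    by (auto simp: reducible_def zk_unit_iff)
  then have "re_part a * re_part b = p ^ n" using assms(3) by simp
  then have "re_part a dvd p ^ n" "re_part b dvd p ^ n" by (metis dvd_triv_left dvd_triv_right)+
  then have "p dvd re_part a" "p dvd re_part b"
    using prime_dvd_if_dvd_prime_power[OF assms(1)] ab(1,2) by blast+
  \<comment> \<open>Each of the two summands of the k-part of a b contains the real part of a or of
    b.\<close>
  then show "p dvd k_part z" using ab(3) by simp
next
  assume "p dvd k_part z"
  then obtain y where y: "k_part z = p * y" ..
  \<comment> \<open>Pulling p out of z leaves real part \<open>p ^ Suc m\<close>, which is still
    divisible by p because n \<ge> 2; hence neither factor is a unit.\<close>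
  obtain m where m: "n = Suc (Suc m)" using assms(2) by (metis add_2_eq_Suc le_Suc_ex)
  have "\<not> p dvd 1" using assms(1) not_prime_unit by blast
  then have "\<not> ZK p 0 dvd 1" "\<not> ZK (p ^ Suc m) y dvd 1"
    unfolding zk_unit_iff zk.sel power_Suc by (blast dest: dvd_mult_left)+
  moreover have "z = ZK p 0 * ZK (p ^ Suc m) y"
    using assms(3) y m by (simp add: zk_eq_iff)
  ultimately show "reducible z" unfolding reducible_def by blast
qed

lemma re_part_power [simp]: "re_part (z ^ n) = re_part z ^ n"
  by (induction n) auto

lemma k_part_of_nat_power [simp]: "k_part (of_nat m ^ n) = 0"
  by (metis of_nat_power parts_of_nat(2))

theorem proposition14:
  fixes z :: zk
  assumes "z \<notin> zero_divisors"
  shows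
    "((irreducible (- z) \<longleftrightarrow> irreducible z) \<and> (reducible (- z) \<longleftrightarrow> reducible z)) \<and>
     (\<forall>(p::nat) (y::int). prime p \<and> z = of_nat p + kk * of_int y \<longrightarrow> irreducible z) \<and>
     (\<forall>(x::int) (y::int). x > 0 \<and> z = of_int x + kk * of_int y \<and>
        \<not> (\<exists>(p::nat) (n::nat). prime p \<and> x = int p ^ n) \<longrightarrow> reducible z) \<and>
     (\<forall>(p::nat) (\<gamma>::nat) (y::int). prime p \<and> \<gamma> \<ge> 2 \<and> z = of_nat p ^ \<gamma> + kk * of_int y \<longrightarrow>
        (reducible z \<longleftrightarrow> int p dvd y))"
proof (intro conjI allI impI)
  show "irreducible (- z) \<longleftrightarrow> irreducible z" by (rule irreducible_uminus_iff)
  show "reducible (- z) \<longleftrightarrow> reducible z" by (rule reducible_uminus_iff)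
next
  fix p :: nat and y :: int
  assume "prime p \<and> z = of_nat p + kk * of_int y"
  then have "prime (re_part z)" by simp
  then show "irreducible z"
    by (intro irreducible_zk_if_irreducible_re_part prime_elem_imp_irreducible prime_imp_prime_elem)
next
  fix x y :: int
  assume "x > 0 \<and> z = of_int x + kk * of_int y \<and>
    \<not> (\<exists>(p::nat) (n::nat). prime p \<and> x = int p ^ n)"
  then show "reducible z" by (intro reducible_if_re_part_not_prime_power) auto
next
  fix p \<gamma> :: nat and y :: int
  assume "prime p \<and> \<gamma> \<ge> 2 \<and> z = of_nat p ^ \<gamma> + kk * of_int y"
  then show "reducible z \<longleftrightarrow> int p dvd y"
    using reducible_prime_power_iff[of "int p" \<gamma> z] by simp
qed

end
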